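(* Let $\mathcal{F}$ be a family of bit-wise independent tampering functions $\mathbb{F}_2^n \to \mathbb{F}_2^n$ and let $D$ be an integer such that every $f = (f_1,\ldots,f_n) \in \mathcal{F}$ satisfies $$|\{\, i : f_i = \mathbf{0} \text{ or } f_i = \mathbf{1} \,\}| \ge D.$$ Let $C$ be an $[n,k,d]$ linear code such that $D > n - d^{\perp}$, where $d^{\perp}$ is the minimal distance of its dual code $C^{\perp}$. Then a linear coset-coding using $C$ is non-malleable with respect to $\mathcal{F}$.
   Context: **Linear codes.** An $[n,k,d]$ linear code is a $k$-dimensional subspace $C$ of $\mathbb{F}_2^n$ with minimal Hamming distance $d$. Its dual is $C^{\perp} = \{y \in \mathbb{F}_2^n : \sum_i x_i y_i = 0 \text{ for all } x \in C\}$. Put $r = n-k$. A parity-check matrix of $C$ is an $r \times n$ matrix $H$ over $\mathbb{F}_2$ of rank $r$ with $C = \{x \in \mathbb{F}_2^n : H\,{}^t x = 0\}$. **Linear coset-coding.** Given $C$ with a parity-check matrix $H$, the linear coset-coding scheme $(\mathrm{Enc}, \mathrm{Dec})$ has message space $\mathbb{F}_2^r$ and codeword space $\mathbb{F}_2^n$. The randomized encoding $\mathrm{Enc}(m)$ of $m \in \mathbb{F}_2^r$ is an element chosen (uniformly) at random among all $x \in \mathbb{F}_2^n$ such that $H\,{}^t x = m$. The deterministic decoding is $\mathrm{Dec}(x) = H\,{}^t x$. **Bit-wise independent functions.** A function $f : \{0,1\}^n \to \{0,1\}^n$ is bit-wise independent if there are functions $f_1,\ldots,f_n : \{0,1\}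 \to \{0,1\}$ with $f(x) = (f_1(x_1),\ldots,f_n(x_n))$ for all $x \in \{0,1\}^n$; one then writes $f = (f_1,\ldots,f_n)$. Each $f_i$ is one of four functions: $\mathbf{keep}$ (identity), $\mathbf{flip}$ ($b \mapsto 1-b$), $\mathbf{0}$ (constant $0$), $\mathbf{1}$ (constant $1$). **Non-malleability.** Let $(\mathrm{Enc},\mathrm{Dec})$ be a coding scheme with randomized $\mathrm{Enc}: \{0,1\}^r \to \{0,1\}^n$ and deterministic $\mathrm{Dec}: \{0,1\}^n \to \{0,1\}^r \cup \{\bot\}$, where $\bot$ means that the word cannot be decoded. For $f : \{0,1\}^n \to \{0,1\}^n$ and $s \in \{0,1\}^r$, let $\mathrm{Tamper}^f_s$ be the random variable $\mathrm{Dec}(f(c))$, where $c$ is drawn as $c \leftarrow \mathrm{Enc}(s)$ (the randomness is that of $\mathrm{Enc}$). The scheme is non-malleable with respect to a family $\mathcal{F}$ of functions $\{0,1\}^n \to \{0,1\}^n$ if for each $f \in \mathcal{F}$ there exists a distribution $\mathcal{D}_f$ over $\{0,1\}^r \cup \{\bot, \mathbf{same}\}$ (depending on $f$ but not on $s$; $\mathbf{same}$ is a special symbol) such that for all $s \in \{0,1\}^r$, $$\mathrm{Tamper}^f_s \approx \{\text{draw } \tilde{s} \leftarrow \mathcal{D}_f;\ \text{output } s \text{ if } \tilde{s} = \mathbf{same}, \text{ and } \tilde{s} \text{ otherwise}\},$$ where $\approx$ denotes computational or statistical indistinguishability. *)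

theory Defs
  imports
    "HOL-Probability.Probability_Mass_Function"
    "HOL-Library.Z2"
    "HOL-Library.Extended_Nat"
    "Jordan_Normal_Form.DL_Rank"
begin

unbundle no vec_syntax
hide_const (open) Finite_Cartesian_Product.vec

section \<open>Binary linear codes\<close>

definition hamming_dist :: "bit vec \<Rightarrow> bit vec \<Rightarrow> nat" where
  "hamming_dist x y = card {i. i < dim_vec x \<and> x $ i \<noteq> y $ i}"

text \<open>A code with a single word has no two distinct words; since \<open>Inf {} = \<infinity>\<close> on
  \<^typ>\<open>enat\<close>, its minimal distance is \<open>\<infinity>\<close> by convention.\<close>

definition min_distance :: "bit vec set \<Rightarrow> enat" where
  "min_distance C = Inf {enat (hamming_dist x y) | x y. x \<in> C \<and> y \<in> C \<and> x \<noteq> y}"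

definition linear_code :: "nat \<Rightarrow> nat \<Rightarrow> enat \<Rightarrow> bit vec set \<Rightarrow> bool" where
  "linear_code n k d C \<longleftrightarrow>
     VectorSpace.subspace class_ring C (module_vec TYPE(bit) n) \<and>
     vectorspace.dim class_ring ((module_vec TYPE(bit) n)\<lparr>carrier := C\<rparr>) = k \<and>
     min_distance C = d"

definition dual_code :: "nat \<Rightarrow> bit vec set \<Rightarrow> bit vec set" where
  "dual_code n C = {y \<in> carrier_vec n. \<forall>x\<in>C. x \<bullet> y = 0}"

text \<open>\<open>vec_space.rank r\<close> is the dimension of the span of the columns, which are
  vectors of length \<open>r\<close>.\<close>

definition parity_check_matrix :: "nat \<Rightarrow> nat \<Rightarrow> bit vec set \<Rightarrow> bit mat \<Rightarrow> bool" where
  "parity_check_matrix r n C H \<longleftrightarrow>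
     H \<in> carrier_mat r n \<and> vec_space.rank r H = r \<and>
     C = {x \<in> carrier_vec n. H *\<^sub>v x = 0\<^sub>v r}"

section \<open>Linear coset-coding\<close>

text \<open>Decoding into an \<open>option\<close> type: \<^const>\<open>None\<close> stands for \<open>\<bottom>\<close>, which coset-coding never
  returns.\<close>

definition coset_enc :: "bit mat \<Rightarrow> bit vec \<Rightarrow> bit vec pmf" where
  "coset_enc H m = pmf_of_set {x \<in> carrier_vec (dim_col H). H *\<^sub>v x = m}"

definition coset_dec :: "bit mat \<Rightarrow> bit vec \<Rightarrow> bit vec option" where
  "coset_dec H x = Some (H *\<^sub>v x)"

section \<open>Bit-wise independent functions\<close>

text \<open>The functions \<open>f\<^sub>1, \<dots>, f\<^sub>n\<close> are indexed from \<open>0\<close>. Only the values of \<open>f\<close> on words of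
  length \<open>n\<close>, and only the \<open>fs i\<close> with \<open>i < n\<close>, are meaningful; \<open>f\<close> determines the latter.\<close>

definition has_components :: "nat \<Rightarrow> (bit vec \<Rightarrow> bit vec) \<Rightarrow> (nat \<Rightarrow> bit \<Rightarrow> bit) \<Rightarrow> bool" where
  "has_components n f fs \<longleftrightarrow> (\<forall>x\<in>carrier_vec n. f x = vec n (\<lambda>i. fs i (x $ i)))"

definition bitwise_independent :: "nat \<Rightarrow> (bit vec \<Rightarrow> bit vec) \<Rightarrow> bool" where
  "bitwise_independent n f \<longleftrightarrow> (\<exists>fs. has_components n f fs)"

section \<open>Non-malleability\<close>

definition stat_dist :: "'a pmf \<Rightarrow> 'a pmf \<Rightarrow> real" where
  "stat_dist p q = (SUP A. \<bar>measure_pmf.prob p A - measure_pmf.prob q A\<bar>)"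

definition stat_indist :: "real \<Rightarrow> 'a pmf \<Rightarrow> 'a pmf \<Rightarrow> bool" where
  "stat_indist \<epsilon> p q \<longleftrightarrow> stat_dist p q \<le> \<epsilon>"

definition tamper ::
  "('m \<Rightarrow> 'c pmf) \<Rightarrow> ('c \<Rightarrow> 'm option) \<Rightarrow> ('c \<Rightarrow> 'c) \<Rightarrow> 'm \<Rightarrow> 'm option pmf" where
  "tamper Enc Dec f s = map_pmf (\<lambda>c. Dec (f c)) (Enc s)"

text \<open>The special symbol \<open>same\<close> is adjoined to the set of decoding results.\<close>

datatype 'a with_same = Same | Result 'a

fun replace_same :: "'m \<Rightarrow> 'm option with_same \<Rightarrow> 'm option" where
  "replace_same s Same = Some s"
| "replace_same s (Result t) = t"

definition simulate :: "'m option with_same pmf \<Rightarrow> 'm \<Rightarrow> 'm option pmf" where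
  "simulate Df s = map_pmf (replace_same s) Df"

text \<open>\<open>M\<close> is the message space and \<open>\<epsilon>\<close> bounds the statistical distance. A single coding scheme
  comes without a security parameter, so indistinguishability is measured concretely;
  \<open>\<epsilon> = 0\<close> means identical distributions.\<close>

definition non_malleable ::
  "real \<Rightarrow> 'm set \<Rightarrow> ('c \<Rightarrow> 'c) set \<Rightarrow> ('m \<Rightarrow> 'c pmf) \<Rightarrow> ('c \<Rightarrow> 'm option) \<Rightarrow> bool" where
  "non_malleable \<epsilon> M F Enc Dec \<longleftrightarrow>
     (\<forall>f\<in>F. \<exists>Df :: 'm option with_same pmf.
        set_pmf Df \<subseteq> {Same, Result None} \<union> (\<lambda>m. Result (Some m)) ` M \<and>
        (\<forall>s\<in>M. stat_indist \<epsilon> (tamper Enc Dec f s) (simulate Df s)))"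

end

theory Submission
  imports Defs
begin

text \<open>Let \<open>T\<close> be the set of positions where \<open>f\<close> is not constant, so that \<open>|T| < d\<^sup>\<bottom>\<close>. If the
  words vanishing on \<open>T\<close> did not realise every syndrome, some non-zero \<open>y\<close> would be orthogonal to
  all the columns of \<open>H\<close> outside \<open>T\<close>, and \<open>y H\<close> would be a non-zero dual codeword of weight at most
  \<open>|T|\<close>. Hence for every message \<open>s\<close> there is a word \<open>z\<close> of syndrome \<open>s\<close> vanishing on \<open>T\<close>.
  Translation by \<open>z\<close> maps the coset of \<open>0\<close> onto the coset of \<open>s\<close> and does not change \<open>f\<close>, so the
  tampered message is distributed as for \<open>s = 0\<close>.\<close>

section \<open>Linear algebra: column spaces and left kernels\<close>

lemma (in vec_space) maximal_indpt_span:
  assumes S: "S \<subseteq> carrier_vec n"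
    and U: "maximal U (\<lambda>T. T \<subseteq> S \<and> lin_indpt T)"
  shows "span U = span S"
proof
  have US: "U \<subseteq> S" and li: "lin_indpt U" using U by (auto simp: maximal_def)
  show "span U \<subseteq> span S" using span_is_monotone[OF US] .
  have "s \<in> span U" if s: "s \<in> S" for s
  proof (cases "s \<in> U")
    case True
    then show ?thesis using span_mem US S by auto
  next
    case False
    then have "lin_dep (U \<union> {s})" using U US s unfolding maximal_def by blast
    then show ?thesis using lin_dep_iff_in_span[of U s] False US S s li by auto
  qed
  then show "span S \<subseteq> span U"
    using span_is_subset[of S "span U"] span_is_submodule[of U] US S by auto
qed

text \<open>Turns \<open>rank\<close> into actual columns that can be counted and rearranged into
  another matrix: a maximal independent set of columns already spans all of them.\<close>

lemma (in vec_space) col_space_basis: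
  assumes A: "A \<in> carrier_mat n nc"
  obtains U where "finite U" "U \<subseteq> set (cols A)" "lin_indpt U" "card U = rank A"
    "span U = col_space A"
proof -
  have "lin_indpt {}" by (simp add: lin_dep_def)
  then obtain U where fin: "finite U"
    and U: "maximal U (\<lambda>T. T \<subseteq> set (cols A) \<and> lin_indpt T)"
    using maximal_exists_superset[of "set (cols A)" "\<lambda>T. T \<subseteq> set (cols A) \<and> lin_indpt T" "{}"]
    by auto
  moreover have "span U = col_space A"
    using maximal_indpt_span[OF _ U] A cols_dim[of A] by (auto simp: col_space_def)
  moreover have "card U = rank A" using rank_card_indpt[OF A U] by simp
  moreover have "U \<subseteq> set (cols A)" "lin_indpt U" using U by (auto simp: maximal_def)
  ultimately show ?thesis using that by blast
qed

lemma (in vec_space) full_rank_col_space: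
  assumes A: "A \<in> carrier_mat n nc" and rank: "rank A = n"
  shows "col_space A = carrier_vec n"
proof -
  obtain U where U: "finite U" "U \<subseteq> set (cols A)" "lin_indpt U" "card U = rank A"
    "span U = col_space A" using col_space_basis[OF A] .
  have "U \<subseteq> carrier_vec n" using U(2) A cols_dim[of A] by auto
  then have "basis U" using dim_li_is_basis[OF fin_dim U(1) _ U(3)] U(4) rank dim_is_n by auto
  then show ?thesis using U(5) by (auto simp: basis_def)
qed

text \<open>Determinants yield kernel vectors only for square matrices, so \<open>A\<close> is
  replaced by a square matrix \<open>B\<close> with the same column space. That space being proper,
  \<open>B\<close> is singular, and a vector killed by \<open>B\<^sup>T\<close> is orthogonal to the
  columns of \<open>A\<close> too.\<close>

lemma (in vec_space) col_space_neq_left_kernel: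
  assumes A: "A \<in> carrier_mat n nc" and neq: "col_space A \<noteq> carrier_vec n"
  obtains y where "y \<in> carrier_vec n" "y \<noteq> 0\<^sub>v n" "A\<^sup>T *\<^sub>v y = 0\<^sub>v nc"
proof -
  obtain U where U: "finite U" "U \<subseteq> set (cols A)" "lin_indpt U" "card U = rank A"
    "span U = col_space A" using col_space_basis[OF A] .
  have UC: "U \<subseteq> carrier_vec n" using U(2) A cols_dim[of A] by auto
  obtain us where us: "set us = U" "length us = card U"
    using finite_distinct_list[OF U(1)] distinct_card by metis
  have le: "card U \<le> n" using li_le_dim(2)[OF fin_dim _ U(3)] UC dim_is_n by auto
  \<comment> \<open>The zero vectors bring the number of columns up to \<open>n\<close> without
    enlarging the span.\<close>
  define vs where "vs = us @ replicate (n - card U) (0\<^sub>v n)"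
  have len: "length vs = n" using us le by (simp add: vs_def)
  have vsC: "set vs \<subseteq> carrier_vec n" using us UC by (auto simp: vs_def)
  define B where "B = mat_of_cols n vs"
  have B: "B \<in> carrier_mat n n" using len by (auto simp: B_def)
  have cols: "cols B = vs" using vsC by (simp add: B_def)
  have sub: "set vs \<subseteq> col_space A"
  proof -
    have "0\<^sub>v n \<in> col_space A" unfolding col_space_eq[OF A]
      using A by (auto intro!: bexI[of _ "0\<^sub>v nc"])
    then show ?thesis using us U(5) span_mem[OF UC[folded module_vec_simps(3)]] UC
      by (auto simp: vs_def intro: span_mem)
  qed
  have "col_space B \<subseteq> col_space A"
  proof -
    have "submodule class_ring (col_space A) V"
      unfolding col_space_def using A cols_dim[of A] by (intro span_is_submodule) auto
    then show ?thesis using span_is_subset[OF sub] by (simp add: col_space_def cols)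
  qed
  moreover have "col_space A \<subseteq> carrier_vec n" using col_space_eq[OF A] A by auto
  ultimately have "col_space B \<noteq> carrier_vec n" using neq by auto
  then have "det B = 0" using full_rank_col_space[OF B] low_rank_det_zero[OF B] by blast
  then have "det B\<^sup>T = 0" using det_transpose[OF B] by simp
  then obtain y where y: "y \<in> carrier_vec n" "y \<noteq> 0\<^sub>v n" "B\<^sup>T *\<^sub>v y = 0\<^sub>v n"
    using det_0_iff_vec_prod_zero_field[of "B\<^sup>T" n] B by auto
  have "c \<bullet> y = 0" if c: "c \<in> set (cols A)" for c
  proof -
    have "c \<in> col_space A"
      unfolding col_space_def using A cols_dim[of A] c by (intro span_mem) auto
    also have "\<dots> = span U" using U(5) by simp
    also have "\<dots> \<subseteq> col_space B"
      unfolding col_space_def cols by (rule span_is_monotone) (auto simp: vs_def us)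
    finally obtain x where x: "x \<in> carrier_vec n" "c = B *\<^sub>v x"
      unfolding col_space_eq[OF B] using B by auto
    \<comment> \<open>Every column of \<open>A\<close> has the form \<open>B *\<^sub>v x\<close>,
      and the pairing with \<open>y\<close> moves \<open>B\<close> over to \<open>y\<close>.\<close>
    have "c \<bullet> y = (B\<^sup>T *\<^sub>v y) \<bullet> x"
      using transpose_vec_mult_scalar[OF B x(1) y(1)] x y B
      by (simp add: comm_scalar_prod[of _ n])
    then show ?thesis using y x by simp
  qed
  then have "A\<^sup>T *\<^sub>v y = 0\<^sub>v nc" using A by (intro eq_vecI) (auto simp: cols_def)
  then show ?thesis using that y by blast
qed

text \<open>Pairing \<open>y\<close> with a preimage of each unit vector reads off its coordinates,
  and transposing \<open>A\<close> to the other side makes them vanish. For a parity-check matrix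
  this shows that a non-zero \<open>y\<close> gives a non-zero dual codeword.\<close>

lemma left_kernel_surj:
  fixes A :: "'a :: comm_ring_1 mat"
  assumes A: "A \<in> carrier_mat nr nc" and y: "y \<in> carrier_vec nr"
    and ker: "A\<^sup>T *\<^sub>v y = 0\<^sub>v nc"
    and surj: "\<And>v. v \<in> carrier_vec nr \<Longrightarrow> \<exists>x\<in>carrier_vec nc. A *\<^sub>v x = v"
  shows "y = 0\<^sub>v nr"
proof (rule eq_vecI)
  fix i assume i: "i < dim_vec (0\<^sub>v nr :: 'a vec)"
  obtain x where x: "x \<in> carrier_vec nc" "A *\<^sub>v x = unit_vec nr i"
    using surj[of "unit_vec nr i"] by auto
  have "y $ i = y \<bullet> (A *\<^sub>v x)" using x y i by simp
  also have "\<dots> = 0" using transpose_vec_mult_scalar[OF A x(1) y] ker x by simp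
  finally show "y $ i = 0\<^sub>v nr $ i" using i by simp
qed (use y in simp)

section \<open>Binary codes: dual codewords, syndromes and cosets\<close>

lemma finite_carrier_vec_bit: "finite (carrier_vec n :: bit vec set)"
proof (rule finite_subset)
  have "finite (UNIV :: bit set)" by (rule finite_subset[of _ "{0, 1}"]) (auto intro: bit.exhaust)
  then show "finite (vec_of_list ` {xs :: bit list. set xs \<subseteq> UNIV \<and> length xs = n})"
    by (intro finite_imageI finite_lists_length_eq)
  show "carrier_vec n \<subseteq> vec_of_list ` {xs :: bit list. set xs \<subseteq> UNIV \<and> length xs = n}"
  proof
    fix v :: "bit vec" assume "v \<in> carrier_vec n"
    then show "v \<in> vec_of_list ` {xs. set xs \<subseteq> UNIV \<and> length xs = n}"
      by (intro image_eqI[of _ _ "list_of_vec v"]) (auto simp: vec_list)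
  qed
qed

text \<open>The zero word is a dual codeword, and the weight of \<open>u\<close> is its distance
  from it.\<close>

lemma min_distance_dual_le_weight:
  assumes u: "u \<in> dual_code n C" "u \<noteq> 0\<^sub>v n" and C: "C \<subseteq> carrier_vec n"
  shows "min_distance (dual_code n C) \<le> enat (card {i. i < n \<and> u $ i \<noteq> 0})"
proof -
  have "0\<^sub>v n \<in> dual_code n C" using C by (auto simp: dual_code_def)
  moreover have "hamming_dist u (0\<^sub>v n) = card {i. i < n \<and> u $ i \<noteq> 0}"
    unfolding hamming_dist_def
    by (rule arg_cong[where f = card]) (use u in \<open>auto simp: dual_code_def\<close>)
  ultimately show ?thesis unfolding min_distance_def using u by (intro Inf_lower) force
qed

lemma syndrome_vanishing_on:
  assumes parity: "parity_check_matrix r n C H"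
    and T: "T \<subseteq> {..<n}" "enat (card T) < min_distance (dual_code n C)"
    and m: "m \<in> carrier_vec r"
  obtains z where "z \<in> carrier_vec n" "H *\<^sub>v z = m" "\<forall>i\<in>T. z $ i = 0"
proof -
  interpret vec_space "TYPE(bit)" r .
  have H: "H \<in> carrier_mat r n" and rank: "rank H = r"
    and C: "C = {x \<in> carrier_vec n. H *\<^sub>v x = 0\<^sub>v r}"
    using parity by (auto simp: parity_check_matrix_def)
  \<comment> \<open>\<open>P\<close> is the projection that erases the positions in
    \<open>T\<close>. Multiplying by it replaces the columns of \<open>H\<close> in \<open>T\<close>
    by zero instead of deleting them, so no positions have to be renumbered.\<close>
  define P :: "bit mat" where "P = mat n n (\<lambda>(i, j). if i = j \<and> i \<notin> T then 1 else 0)"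
  have P: "P \<in> carrier_mat n n" by (simp add: P_def)
  have P_nth: "(P *\<^sub>v x) $ i = (if i \<in> T then 0 else x $ i)"
    if "x \<in> carrier_vec n" "i < n" for x i
  proof -
    have "row P i = (if i \<in> T then 0\<^sub>v n else unit_vec n i)"
      using that by (intro eq_vecI) (auto simp: P_def)
    then show ?thesis using that P by auto
  qed
  have PT: "P\<^sup>T = P" by (rule eq_matI) (auto simp: P_def)
  have HP: "H * P \<in> carrier_mat r n" using H P by simp
  have "col_space (H * P) = carrier_vec r"
  proof (rule ccontr)
    assume "col_space (H * P) \<noteq> carrier_vec r"
    then obtain y where y: "y \<in> carrier_vec r" "y \<noteq> 0\<^sub>v r" "(H * P)\<^sup>T *\<^sub>v y = 0\<^sub>v n"
      using col_space_neq_left_kernel[OF HP] by blast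
    define u where "u = H\<^sup>T *\<^sub>v y"
    have u: "u \<in> carrier_vec n" using H y by (simp add: u_def)
    \<comment> \<open>As \<open>P\<close> is symmetric, \<open>(H * P)\<^sup>T *\<^sub>v y\<close>
      is \<open>P *\<^sub>v u\<close>. Its vanishing confines the support of \<open>u\<close> to
      \<open>T\<close>.\<close>
    have "P *\<^sub>v u = 0\<^sub>v n"
      using y H P by (simp add: u_def transpose_mult[OF H P] PT)
    then have "u $ i = 0" if "i < n" "i \<notin> T" for i
      using P_nth[OF u that(1)] that by simp
    then have "{i. i < n \<and> u $ i \<noteq> 0} \<subseteq> T" by blast
    then have "card {i. i < n \<and> u $ i \<noteq> 0} \<le> card T"
      using T(1) finite_subset by (intro card_mono) auto
    moreover have "u \<noteq> 0\<^sub>v n"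
    proof
      assume "u = 0\<^sub>v n"
      moreover have "\<exists>x\<in>carrier_vec n. H *\<^sub>v x = v" if "v \<in> carrier_vec r" for v
        using full_rank_col_space[OF H rank] col_space_eq[OF H] H that by auto
      ultimately show False using left_kernel_surj[OF H y(1)] y(2) by (auto simp: u_def)
    qed
    moreover have "u \<in> dual_code n C"
      unfolding dual_code_def
    proof (intro CollectI conjI u ballI)
      fix x assume x: "x \<in> C"
      then have "u \<bullet> x = y \<bullet> (H *\<^sub>v x)"
        unfolding u_def using transpose_vec_mult_scalar[OF H _ y(1)] C by auto
      also have "\<dots> = 0" using x y C by simp
      finally show "x \<bullet> u = 0" using u x C by (simp add: comm_scalar_prod[of _ n])
    qed
    moreover have "C \<subseteq> carrier_vec n" using C by blast
    ultimately have "min_distance (dual_code n C) \<le> enat (card T)"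
      using min_distance_dual_le_weight[of u n C] by (meson enat_ord_simps(1) order_trans)
    then show False using T(2) by simp
  qed
  then obtain x where x: "x \<in> carrier_vec n" "(H * P) *\<^sub>v x = m"
    using col_space_eq[OF HP] HP H P m by fastforce
  \<comment> \<open>The witness is the projected word \<open>P *\<^sub>v x\<close>; \<open>x\<close>
    itself may be non-zero on \<open>T\<close>.\<close>
  have "H *\<^sub>v (P *\<^sub>v x) = m" using x H P by simp
  moreover have "\<forall>i\<in>T. (P *\<^sub>v x) $ i = 0"
    using P_nth[OF x(1)] T(1) by (simp add: subset_iff del: index_mult_mat_vec)
  moreover have "P *\<^sub>v x \<in> carrier_vec n" using P x by simp
  ultimately show ?thesis using that by blast
qed

text \<open>Translation by \<open>z\<close> is a bijection from the kernel of \<open>H\<close> onto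
  the coset of \<open>z\<close>, and a bijection carries a uniform distribution to a uniform
  one.\<close>

lemma coset_enc_translate:
  assumes H: "H \<in> carrier_mat r n" and z: "z \<in> carrier_vec n"
  shows "coset_enc H (H *\<^sub>v z) = map_pmf (\<lambda>x. x + z) (coset_enc H (0\<^sub>v r))"
proof -
  let ?K = "{x \<in> carrier_vec n. H *\<^sub>v x = 0\<^sub>v r}"
  let ?L = "{x \<in> carrier_vec n. H *\<^sub>v x = H *\<^sub>v z}"
  have "(\<lambda>x. x + z) ` ?K = ?L"
  proof
    show "(\<lambda>x. x + z) ` ?K \<subseteq> ?L"
      using H z by (auto simp: mult_add_distrib_mat_vec[OF H])
    show "?L \<subseteq> (\<lambda>x. x + z) ` ?K"
    proof
      fix x assume x: "x \<in> ?L"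
      have "x = (x - z) + z" using x z by (intro eq_vecI) auto
      moreover have "x - z \<in> ?K"
        using x H z by (auto simp: mult_minus_distrib_mat_vec[OF H])
      ultimately show "x \<in> (\<lambda>x. x + z) ` ?K" by blast
    qed
  qed
  moreover have "inj_on (\<lambda>x. x + z) ?K"
  proof (rule inj_onI)
    fix a b assume ab: "a \<in> ?K" "b \<in> ?K" "a + z = b + z"
    have "a = (a + z) - z" "b = (b + z) - z" using ab(1,2) z by (auto intro!: eq_vecI)
    then show "a = b" using ab(3) by simp
  qed
  moreover have "finite ?K" by (rule finite_subset[OF _ finite_carrier_vec_bit]) auto
  \<comment> \<open>\<open>pmf_of_set\<close> is the uniform distribution only on a finite non-empty
    set.\<close>
  moreover have "0\<^sub>v n \<in> ?K" using H by auto
  ultimately show ?thesis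
    unfolding coset_enc_def using H by (subst map_pmf_of_set_inj) auto
qed

lemma set_pmf_coset_enc:
  assumes H: "H \<in> carrier_mat r n" and z: "z \<in> carrier_vec n"
  shows "set_pmf (coset_enc H (H *\<^sub>v z)) \<subseteq> carrier_vec n"
proof -
  have "finite {x \<in> carrier_vec n. H *\<^sub>v x = H *\<^sub>v z}"
    by (rule finite_subset[OF _ finite_carrier_vec_bit]) auto
  then show ?thesis unfolding coset_enc_def using H z by (subst set_pmf_of_set) auto
qed

section \<open>Tampering by a bit-wise independent function\<close>

theorem theorem2:
  fixes n k :: nat and d :: enat and D :: int and \<epsilon> :: real
    and C :: "bit vec set" and H :: "bit mat" and F :: "(bit vec \<Rightarrow> bit vec) set"
  assumes bitwise: "\<And>f. f \<in> F \<Longrightarrow> bitwise_independent n f"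
    and const: "\<And>f fs. f \<in> F \<Longrightarrow> has_components n f fs \<Longrightarrow>
      int (card {i. i < n \<and> (fs i = (\<lambda>_. 0) \<or> fs i = (\<lambda>_. 1))}) \<ge> D"
    and code: "linear_code n k d C"
    and dist: "ereal (of_int D) > ereal (of_nat n) - ereal_of_enat (min_distance (dual_code n C))"
    and parity: "parity_check_matrix (n - k) n C H"
    and eps: "\<epsilon> \<ge> 0"
  shows "non_malleable \<epsilon> (carrier_vec (n - k)) F (coset_enc H) (coset_dec H)"
  unfolding non_malleable_def
proof
  fix f assume f: "f \<in> F"
  define r where "r = n - k"
  have H: "H \<in> carrier_mat r n" using parity by (simp add: parity_check_matrix_def r_def)
  obtain fs where fs: "has_components n f fs"
    using bitwise[OF f] by (auto simp: bitwise_independent_def)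
  define K where "K = {i. i < n \<and> (fs i = (\<lambda>_. 0) \<or> fs i = (\<lambda>_. 1))}"
  define T where "T = {..<n} - K"
  have K: "K \<subseteq> {..<n}" by (auto simp: K_def)
  \<comment> \<open>Over the reals the difference is not truncated and can be compared with
    \<open>dist\<close>.\<close>
  have card_T: "real (card T) = real n - real (card K)"
    using K card_mono[OF _ K] by (simp add: T_def card_Diff_subset finite_subset)
  have "enat (card T) < min_distance (dual_code n C)"
  \<comment> \<open>An infinite value occurs when the dual code has no two distinct words; it
    exceeds the size of any \<open>T\<close>.\<close>
  proof (cases "min_distance (dual_code n C)")
    case (enat e)
    have "D \<le> int (card K)" using const[OF f fs] by (simp add: K_def)
    then have "real n - real e < real (card K)" using dist by (simp add: enat)
    then show ?thesis using card_T by (simp add: enat)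
  qed simp
  then have syndrome: "\<exists>z\<in>carrier_vec n. H *\<^sub>v z = s \<and> (\<forall>i\<in>T. z $ i = 0)"
    if "s \<in> carrier_vec r" for s
    using syndrome_vanishing_on[OF parity, of T s] that by (auto simp: T_def r_def)
  define p where "p = tamper (coset_enc H) (coset_dec H) f (0\<^sub>v r)"
  have tamper_eq: "tamper (coset_enc H) (coset_dec H) f s = p" if s: "s \<in> carrier_vec r" for s
  proof -
    obtain z where z: "z \<in> carrier_vec n" "H *\<^sub>v z = s" "\<forall>i\<in>T. z $ i = 0"
      using syndrome[OF s] by blast
    have "f (x + z) = f x" if x: "x \<in> carrier_vec n" for x
    proof -
      \<comment> \<open>On \<open>T\<close> the word \<open>z\<close> is zero; off \<open>T\<close>
        the function \<open>fs i\<close> is constant.\<close>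
      have "fs i ((x + z) $ i) = fs i (x $ i)" if "i < n" for i
        using that x z by (cases "i \<in> T") (auto simp: T_def K_def)
      then show ?thesis using fs x z by (auto simp: has_components_def)
    qed
    \<comment> \<open>\<open>fs\<close> describes \<open>f\<close> only on words of length
      \<open>n\<close>, so the invariance under translation is available only on the support of the
      encoding.\<close>
    moreover have "set_pmf (coset_enc H (0\<^sub>v r)) \<subseteq> carrier_vec n"
    proof -
      have "H *\<^sub>v 0\<^sub>v n = 0\<^sub>v r" using H by auto
      then show ?thesis using set_pmf_coset_enc[OF H, of "0\<^sub>v n"] by simp
    qed
    ultimately show ?thesis
      unfolding tamper_def p_def z(2)[symmetric] coset_enc_translate[OF H z(1)]
      by (auto simp: pmf.map_comp intro!: map_pmf_cong)
  qed
  show "\<exists>Df. set_pmf Df \<subseteq> {Same, Result None} \<union> (\<lambda>m. Result (Some m)) ` carrier_vec (n - k) \<and>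
      (\<forall>s\<in>carrier_vec (n - k).
        stat_indist \<epsilon> (tamper (coset_enc H) (coset_dec H) f s) (simulate Df s))"
  \<comment> \<open>The simulator outputs the tampered decoding of the zero message and never
    \<open>Same\<close>. The two distributions then coincide, so their distance is zero.\<close>
  proof (intro exI conjI ballI)
    show "set_pmf (map_pmf Result p)
        \<subseteq> {Same, Result None} \<union> (\<lambda>m. Result (Some m)) ` carrier_vec (n - k)"
    proof -
      have "H *\<^sub>v v \<in> carrier_vec (n - k)" for v
        using H[THEN carrier_matD(1)] by (auto simp: r_def intro: carrier_vecI)
      then show ?thesis by (auto simp: p_def tamper_def coset_dec_def)
    qed
    fix s :: "bit vec" assume "s \<in> carrier_vec (n - k)"
    then have "tamper (coset_enc H) (coset_dec H) f s = simulate (map_pmf Result p) s"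
      using tamper_eq by (simp add: r_def simulate_def pmf.map_comp o_def)
    then show "stat_indist \<epsilon> (tamper (coset_enc H) (coset_dec H) f s)
        (simulate (map_pmf Result p) s)"
      using eps by (simp add: stat_indist_def stat_dist_def)
  qed
qed

end
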